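(* Let $f\in\mathbb R[w_1,\dots,w_d]$ be a non-zero polynomial with $f\ge0$ on $\mathbb R^d$ and $f(0)=0$, and let $g(w)=\prod_{h=1}^dw_h^{s_h-1}$ with $s\in\mathbb R^d_{>0}$. Then the simplex upper bound $\lambda_{\mathrm{smplx}}$ of $(f,g)$ satisfies $$\lambda_{\mathrm{smplx}}\le\frac{\sum_{h=1}^ds_h}{2}.$$
   Context: Write $f(w)=\sum_{j=1}^nc_jw^{a_{*j}}$ with $c_j\neq0$ and pairwise distinct $a_{*j}=(a_{1j},\dots,a_{dj})^\top\in\mathbb N_0^d$, where $w^a=\prod_hw_h^{a_h}$. The simplex upper bound $\lambda_{\mathrm{smplx}}\in(0,\infty]$ of $(f,g)$ is defined by $$\frac1{\lambda_{\mathrm{smplx}}}=\max_{\alpha\in S_{d-1}}\ \min_{j=1,\dots,n}\ \sum_{h=1}^d\alpha_h\frac{a_{hj}}{s_h},\qquad S_{d-1}=\Big\{\alpha\in\mathbb R^d:\alpha_h\ge0,\ \sum_{h=1}^d\alpha_h=1\Big\},$$ with $\lambda_{\mathrm{smplx}}=\infty$ if the right-hand side is $0$. *)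

theory Defs
  imports "HOL-Analysis.Analysis" "HOL-Library.Poly_Mapping"
begin

text \<open>
  The variables are indexed by a finite type \<open>'d\<close>, so that \<open>d = CARD('d)\<close>.
  An exponent vector is an element of \<open>'d \<Rightarrow>\<^sub>0 nat\<close>, and the polynomial ring is
  \<open>('d \<Rightarrow>\<^sub>0 nat) \<Rightarrow>\<^sub>0 real\<close> with its convolution product. The exponent vectors occurring
  in \<open>f\<close> (with coefficient \<open>\<noteq> 0\<close>, hence pairwise distinct and finite in number) are \<open>keys f\<close>.
\<close>

type_synonym 'd real_mpoly = "('d \<Rightarrow>\<^sub>0 nat) \<Rightarrow>\<^sub>0 real"

definition mpoly_eval :: "('d::finite) real_mpoly \<Rightarrow> real ^ 'd \<Rightarrow> real" where
  "mpoly_eval f w =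
     (\<Sum>a \<in> Poly_Mapping.keys f.
        Poly_Mapping.lookup f a * (\<Prod>h\<in>UNIV. (w $ h) ^ Poly_Mapping.lookup a h))"

definition std_simplex :: "(real ^ ('d::finite)) set" where
  "std_simplex = {\<alpha>. (\<forall>h. 0 \<le> \<alpha> $ h) \<and> (\<Sum>h\<in>UNIV. \<alpha> $ h) = 1}"

definition simplex_min :: "('d::finite) real_mpoly \<Rightarrow> real ^ 'd \<Rightarrow> real ^ 'd \<Rightarrow> real" where
  "simplex_min f s \<alpha> =
     Min ((\<lambda>a. \<Sum>h\<in>UNIV. \<alpha> $ h * (real (Poly_Mapping.lookup a h) / s $ h))
            ` Poly_Mapping.keys f)"

text \<open>
  The supremum below is a maximum for every \<open>f \<noteq> 0\<close>; see \<open>simplex_max_attained\<close>.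
\<close>

definition simplex_max :: "('d::finite) real_mpoly \<Rightarrow> real ^ 'd \<Rightarrow> real" where
  "simplex_max f s = (SUP \<alpha>\<in>std_simplex. simplex_min f s \<alpha>)"

text \<open>
  The monomial \<open>g(w) = (\<Prod>h. w\<^sub>h powr (s\<^sub>h - 1))\<close> is given by its vector \<open>s\<close>, through which
  alone it enters the definition of the bound of \<open>(f, g)\<close>.
\<close>

definition simplex_upper_bound :: "('d::finite) real_mpoly \<Rightarrow> real ^ 'd \<Rightarrow> ereal" where
  "simplex_upper_bound f s =
     (if simplex_max f s = 0 then \<infinity> else ereal (1 / simplex_max f s))"

lemma compact_std_simplex: "compact (std_simplex :: (real ^ ('d::finite)) set)"
proof -
  have "closed {\<alpha>::real^'d. (\<forall>h. 0 \<le> \<alpha> $ h) \<and> (\<Sum>h\<in>UNIV. \<alpha> $ h) = 1}"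
    by (intro closed_Collect_conj closed_Collect_all closed_Collect_le closed_Collect_eq
          continuous_intros)
  moreover have "norm \<alpha> \<le> 1" if "\<alpha> \<in> std_simplex" for \<alpha> :: "real^'d"
    using norm_le_l1_cart[of \<alpha>] that by (simp add: std_simplex_def)
  ultimately show ?thesis
    by (auto simp: compact_eq_bounded_closed bounded_iff std_simplex_def)
qed

lemma std_simplex_nonempty: "(std_simplex :: (real ^ ('d::finite)) set) \<noteq> {}"
proof -
  have "(\<chi> h. 1 / real CARD('d)) \<in> (std_simplex :: (real ^ 'd) set)"
    by (simp add: std_simplex_def)
  then show ?thesis by blast
qed

lemma continuous_on_Min_image:
  fixes F :: "'a \<Rightarrow> 'b::topological_space \<Rightarrow> real"
  assumes "finite K" "K \<noteq> {}" "\<And>a. a \<in> K \<Longrightarrow> continuous_on S (F a)"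
  shows "continuous_on S (\<lambda>x. Min ((\<lambda>a. F a x) ` K))"
  using assms
proof (induction K rule: finite_ne_induct)
  case (singleton a)
  then show ?case by simp
next
  case (insert a K)
  then have "continuous_on S (\<lambda>x. min (F a x) (Min ((\<lambda>a. F a x) ` K)))"
    by (intro continuous_on_min) auto
  with insert show ?case by simp
qed

lemma simplex_max_attained:
  fixes f :: "('d::finite) real_mpoly"
  assumes "f \<noteq> 0"
  obtains \<alpha> where "\<alpha> \<in> std_simplex" "simplex_max f s = simplex_min f s \<alpha>"
    and "\<And>\<beta>. \<beta> \<in> std_simplex \<Longrightarrow> simplex_min f s \<beta> \<le> simplex_min f s \<alpha>"
proof -
  have "continuous_on std_simplex (simplex_min f s)"
    unfolding simplex_min_def
    using assms by (intro continuous_on_Min_image continuous_intros) auto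
  then obtain \<alpha> where \<alpha>: "\<alpha> \<in> std_simplex"
      "\<And>\<beta>. \<beta> \<in> std_simplex \<Longrightarrow> simplex_min f s \<beta> \<le> simplex_min f s \<alpha>"
    using continuous_attains_sup[OF compact_std_simplex std_simplex_nonempty] by blast
  then have "simplex_max f s = simplex_min f s \<alpha>"
    unfolding simplex_max_def by (intro cSup_eq_maximum) auto
  with \<alpha> that show ?thesis by blast
qed

end

theory Submission imports Defs begin

text \<open>
  With \<open>\<alpha>\<^sub>h = s\<^sub>h / (\<Sum>k. s\<^sub>k)\<close> the inner minimum becomes the least total degree of a monomial of
  \<open>f\<close>, divided by \<open>\<Sum>k. s\<^sub>k\<close>. This degree is at least 2: \<open>f\<close> has no constant term since \<open>f 0 = 0\<close>,
  and no linear term since \<open>0\<close> is a minimum of \<open>f\<close>, so that the partial derivatives vanish there.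
\<close>

lemma mpoly_eval_zero:
  fixes f :: "('d::finite) real_mpoly"
  shows "mpoly_eval f 0 = Poly_Mapping.lookup f 0"
proof -
  \<comment> \<open>The convention \<open>0 ^ 0 = 1\<close> keeps the constant monomial alive at the
    origin; any positive exponent contributes a factor 0.\<close>
  have "(\<Prod>h\<in>UNIV. ((0::real^'d) $ h) ^ Poly_Mapping.lookup a h) = (if a = 0 then 1 else 0)"
    for a :: "'d \<Rightarrow>\<^sub>0 nat"
    by (auto simp: poly_mapping_eq_iff fun_eq_iff)
  then have "mpoly_eval f 0 =
      (\<Sum>a\<in>Poly_Mapping.keys f. Poly_Mapping.lookup f a * (if a = 0 then 1 else 0))"
    by (simp only: mpoly_eval_def)
  then show ?thesis
    by (simp add: in_keys_iff if_distrib cong: if_cong split: if_splits)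
qed

text \<open>All coordinates other than \<open>h\<close> vanish on the axis, so a single positive
  exponent elsewhere kills the monomial.\<close>

lemma monomial_axis:
  fixes a :: "'d::finite \<Rightarrow>\<^sub>0 nat"
  shows "(\<Prod>k\<in>UNIV. ((axis h t :: real^'d) $ k) ^ Poly_Mapping.lookup a k) =
    (if \<forall>k. k \<noteq> h \<longrightarrow> Poly_Mapping.lookup a k = 0 then t ^ Poly_Mapping.lookup a h else 0)"
proof -
  have "(\<Prod>k\<in>UNIV. ((axis h t :: real^'d) $ k) ^ Poly_Mapping.lookup a k) =
      t ^ Poly_Mapping.lookup a h * (\<Prod>k\<in>UNIV - {h}. 0 ^ Poly_Mapping.lookup a k)"
    by (subst prod.remove[of _ h]) (auto simp: axis_def intro!: prod.cong)
  then show ?thesis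
    by (auto simp: power_0_left)
qed

text \<open>On the axis a monomial is either identically 0 or a pure power of \<open>t\<close>, and
  among pure powers only \<open>t\<close> itself has nonzero slope at 0.\<close>

lemma monomial_axis_deriv_zero:
  fixes a :: "'d::finite \<Rightarrow>\<^sub>0 nat"
  shows "((\<lambda>t. \<Prod>k\<in>UNIV. ((axis h t :: real^'d) $ k) ^ Poly_Mapping.lookup a k)
    has_real_derivative (if a = Poly_Mapping.single h 1 then 1 else 0)) (at 0)"
proof (cases "\<forall>k. k \<noteq> h \<longrightarrow> Poly_Mapping.lookup a k = 0")
  case True
  then have "a = Poly_Mapping.single h 1 \<longleftrightarrow> Poly_Mapping.lookup a h = 1"
    by (auto simp: poly_mapping_eq_iff fun_eq_iff lookup_single when_def)
  with True show ?thesis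
    unfolding monomial_axis
    by (auto intro!: derivative_eq_intros)
next
  case False
  then have "a \<noteq> Poly_Mapping.single h 1"
    by (auto simp: lookup_single when_def)
  with False show ?thesis
    by (simp only: monomial_axis if_False DERIV_const)
qed

text \<open>Termwise differentiation reads off a linear coefficient as a partial derivative at the
  origin, which turns the minimality of \<open>f\<close> there into a statement about
  coefficients.\<close>

lemma mpoly_eval_axis_deriv_zero:
  fixes f :: "('d::finite) real_mpoly"
  shows "((\<lambda>t. mpoly_eval f (axis h t)) has_real_derivative
    Poly_Mapping.lookup f (Poly_Mapping.single h 1)) (at 0)"
proof -
  have "((\<lambda>t. mpoly_eval f (axis h t)) has_real_derivative
      (\<Sum>a\<in>Poly_Mapping.keys f. Poly_Mapping.lookup f a *
         (if a = Poly_Mapping.single h 1 then 1 else 0))) (at 0)"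
    unfolding mpoly_eval_def
    by (intro DERIV_sum DERIV_cmult monomial_axis_deriv_zero)
  then show ?thesis
    by (simp add: in_keys_iff if_distrib cong: if_cong split: if_splits)
qed

lemma degree_ge_2_if_nonneg:
  fixes f :: "('d::finite) real_mpoly"
  assumes nonneg: "\<And>w. mpoly_eval f w \<ge> 0" and zero: "mpoly_eval f 0 = 0"
    and a: "a \<in> Poly_Mapping.keys f"
  shows "(\<Sum>h\<in>UNIV. Poly_Mapping.lookup a h) \<ge> 2"
proof (rule ccontr)
  assume "\<not> ?thesis"
  then consider "(\<Sum>h\<in>UNIV. Poly_Mapping.lookup a h) = 0" | "(\<Sum>h\<in>UNIV. Poly_Mapping.lookup a h) = 1"
    by linarith
  then show False
  proof cases
    case 1
    then have "a = 0"
      by (auto simp: poly_mapping_eq_iff fun_eq_iff)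
    with a zero show False
      by (simp add: mpoly_eval_zero in_keys_iff)
  next
    case 2
    \<comment> \<open>Natural numbers with sum 1 are all 0 except for a single 1.\<close>
    then obtain h where "Poly_Mapping.lookup a h = 1" "\<And>k. k \<noteq> h \<Longrightarrow> Poly_Mapping.lookup a k = 0"
      using sum_eq_1_iff[of UNIV "Poly_Mapping.lookup a"] by auto
    then have single: "a = Poly_Mapping.single h 1"
      by (auto simp: poly_mapping_eq_iff fun_eq_iff lookup_single when_def)
    have "axis h 0 = (0 :: real^'d)"
      by (simp add: axis_def vec_eq_iff)
    \<comment> \<open>The minimum at the origin is global, so the radius 1 is arbitrary; it only
      matches the form of \<open>DERIV_local_min\<close>.\<close>
    then have "\<forall>t. \<bar>0 - t\<bar> < 1 \<longrightarrow> mpoly_eval f (axis h 0) \<le> mpoly_eval f (axis h t)"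
      by (simp only: zero nonneg simp_thms)
    then have "Poly_Mapping.lookup f a = 0"
      using DERIV_local_min[OF mpoly_eval_axis_deriv_zero[of f h] zero_less_one] single by simp
    with a show False
      by (simp add: in_keys_iff)
  qed
qed

text \<open>Attainment of the maximum supplies the upper bound that a real supremum needs in order
  to dominate its members.\<close>

lemma simplex_min_le_max:
  assumes "f \<noteq> 0" "\<beta> \<in> std_simplex"
  shows "simplex_min f s \<beta> \<le> simplex_max f s"
  using simplex_max_attained[OF assms(1), of s] assms(2) by metis

theorem proposition4p6:
  fixes f :: "('d::finite) real_mpoly" and s :: "real ^ 'd"
  assumes "f \<noteq> 0"
    and "\<forall>w. mpoly_eval f w \<ge> 0"
    and "mpoly_eval f 0 = 0"
    and "\<forall>h. s $ h > 0"
  shows "simplex_upper_bound f s \<le> ereal ((\<Sum>h\<in>UNIV. s $ h) / 2)"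
proof -
  define S where "S = (\<Sum>h\<in>UNIV. s $ h)"
  define \<beta> :: "real^'d" where "\<beta> = (\<chi> h. s $ h / S)"
  have S: "S > 0"
    unfolding S_def using assms(4) by (intro sum_pos) auto
  have \<beta>: "\<beta> \<in> std_simplex"
    using S assms(4)
    by (auto simp: std_simplex_def \<beta>_def less_imp_le simp flip: sum_divide_distrib S_def)
  have "2 / S \<le> (\<Sum>h\<in>UNIV. \<beta> $ h * (real (Poly_Mapping.lookup a h) / s $ h))"
    if "a \<in> Poly_Mapping.keys f" for a
  proof -
    have "2 \<le> (\<Sum>h\<in>UNIV. Poly_Mapping.lookup a h)"
      using degree_ge_2_if_nonneg[OF _ assms(3) that] assms(2) by blast
    then have "2 / S \<le> real (\<Sum>h\<in>UNIV. Poly_Mapping.lookup a h) / S"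
      using S by (intro divide_right_mono) linarith+
    also have "\<dots> = (\<Sum>h\<in>UNIV. real (Poly_Mapping.lookup a h) / S)"
      by (simp add: sum_divide_distrib)
    \<comment> \<open>The numerator of \<open>\<beta> $ h\<close> cancels the denominator
      \<open>s $ h\<close>, which is nonzero by positivity.\<close>
    also have "\<dots> = (\<Sum>h\<in>UNIV. \<beta> $ h * (real (Poly_Mapping.lookup a h) / s $ h))"
      using assms(4) by (intro sum.cong) (auto simp: \<beta>_def less_imp_neq[symmetric])
    finally show ?thesis .
  qed
  then have "2 / S \<le> simplex_min f s \<beta>"
    unfolding simplex_min_def using assms(1) by (intro Min.boundedI) auto
  also have "\<dots> \<le> simplex_max f s"
    using assms(1) \<beta> by (rule simplex_min_le_max)
  finally have max: "2 / S \<le> simplex_max f s" .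
  moreover from S have "0 < 2 / S"
    by simp
  \<comment> \<open>Strict positivity excludes the infinite case of the bound and allows passing to
    reciprocals.\<close>
  ultimately have "simplex_max f s > 0"
    by linarith
  moreover from this max S have "1 / simplex_max f s \<le> S / 2"
    by (simp add: field_simps)
  ultimately show ?thesis
    by (simp add: simplex_upper_bound_def S_def)
qed

end
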